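(* There exist absolute constants $\varepsilon>0$ and $q^*\ge 1/50$ such that for every $q\in[0,q^*]$ the following holds. Let $T$ be a BCMRT$(q)$ of size $2n$ with true coloring $\pi$. Then the probability that there exists a valid coloring $\sigma$ of $T$ satisfying both $$\left|m(\sigma)-\frac n2\right|\le\varepsilon n\qquad\text{and}\qquad M_T^\sigma\ge 2(1-q)(n-1)-n^{2/3}$$ tends to $0$ as $n\to+\infty$.
   Context: BCMRT$(q)$ (balanced community modulated random recursive tree), $q\in[0,1]$: $T_1$ is a single edge (the root edge) joining two nodes with time-label $1$, one of type $A$, denoted $(1,A)$, and one of type $B$, denoted $(1,B)$. At each step $n\ge 2$, two new nodes with time-label $n$, namely $(n,A)$ of type $A$ and $(n,B)$ of type $B$, are added to the tree $T_{n-1}$ of size $2(n-1)$: (1) the two nodes independently (of each other and of the past) decide to connect to a node of their own type with probability $1-q$, or to a node of the other type with probability $q$; (2) each then independently chooses its parent uniformly among the $n-1$ nodes of $T_{n-1}$ of the selected type and is joined to it by an edge. This yields the tree $T=T_n$ of size $2n$. A valid coloring $\sigma$ of $T$ assigns color $A$ or $B$ to each node so that, for each time label $i\in\{1,\dots,n\}$, one of the two nodes with label $i$ has color $A$ and the other has color $B$. The true coloring $\pi$ assigns to each node its type. $m(\sigma)=\sum_{i=1}^n\mathbf 1_{\{\sigma_i=\pi_i\}}$ is the number of time labels $i$ for which $\sigma$ and $\pi$ agree on the pair of nodes with label $i$ (correctly colored pairs). $M_T^\sigma$ is the number of monochromatic edges of $T$ with respect to $\sigma$, i.e. edges whose two endpoints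 have the same color under $\sigma$. *)

theory Defs
  imports "HOL-Probability.Probability"
begin

text \<open>Types of nodes; also used as colors.\<close>

datatype community = A | B

fun other :: "community \<Rightarrow> community" where
  "other A = B"
| "other B = A"

text \<open>The node with time-label \<open>i\<close> and type \<open>c\<close> is \<open>(i, c)\<close>. A tree of size \<open>2 * n\<close> has node
  set \<open>{1..n} \<times> UNIV\<close>, so it is represented by its set of (undirected) edges alone.\<close>

type_synonym node = "nat \<times> community"
type_synonym tree = "node set set"

text \<open>Law of the parent of a new node of type \<open>c\<close> joining a tree with time-labels \<open>1, \<dots>, k\<close>.\<close>

definition parent_pmf :: "real \<Rightarrow> nat \<Rightarrow> community \<Rightarrow> node pmf" where
  "parent_pmf q k c =
     do {
       cross \<leftarrow> bernoulli_pmf q;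
       pmf_of_set {v \<in> {1..k} \<times> UNIV. snd v = (if cross then other c else c)}
     }"

text \<open>Law of the tree \<open>T\<^sub>n\<close>; the case \<open>n = 0\<close> is a dummy. The parameter is meant to satisfy
  \<open>0 \<le> q \<le> 1\<close>, as \<^const>\<open>bernoulli_pmf\<close> truncates other values.\<close>

fun bcmrt :: "real \<Rightarrow> nat \<Rightarrow> tree pmf" where
  "bcmrt q 0 = return_pmf {}"
| "bcmrt q (Suc 0) = return_pmf {{(1, A), (1, B)}}"
| "bcmrt q (Suc (Suc k)) =
     do {
       T \<leftarrow> bcmrt q (Suc k);
       a \<leftarrow> parent_pmf q (Suc k) A;
       b \<leftarrow> parent_pmf q (Suc k) B;
       return_pmf (T \<union> {{(Suc (Suc k), A), a}, {(Suc (Suc k), B), b}})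
     }"

text \<open>Colorings are total functions; only their values on \<open>{1..n} \<times> UNIV\<close> matter below.\<close>

definition valid_coloring :: "nat \<Rightarrow> (node \<Rightarrow> community) \<Rightarrow> bool" where
  "valid_coloring n \<sigma> \<longleftrightarrow> (\<forall>i\<in>{1..n}. {\<sigma> (i, A), \<sigma> (i, B)} = {A, B})"

definition true_coloring :: "node \<Rightarrow> community" where
  "true_coloring v = snd v"

definition correct_pairs :: "nat \<Rightarrow> (node \<Rightarrow> community) \<Rightarrow> nat" where
  "correct_pairs n \<sigma> = card {i \<in> {1..n}. \<forall>c. \<sigma> (i, c) = true_coloring (i, c)}"

definition mono_edges :: "tree \<Rightarrow> (node \<Rightarrow> community) \<Rightarrow> nat" where
  "mono_edges T \<sigma> = card {e \<in> T. \<forall>u\<in>e. \<forall>v\<in>e. \<sigma> u = \<sigma> v}"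

end

theory Submission
  imports Defs "HOL-Real_Asymp.Real_Asymp"
begin

text \<open>The proof is a first moment argument over the sets \<open>S\<close> of correctly colored labels, with the
  exponential weight \<open>8\<close> per monochromatic edge. Given \<open>S\<close>, the expected weight is at most a product
  over the steps, and the two choices of the color of label \<open>k + 1\<close> together contribute at most
  \<open>(81 + 49 d\<^sub>k\<^sup>2) / 2\<close>, where \<open>d\<^sub>k \<in> [-1, 1]\<close> is the excess proportion of correct labels among the first
  \<open>k\<close>. After division by these factors, the sum over all \<open>S\<close> of the products is bounded. If \<open>S\<close> is
  nearly balanced at time \<open>n\<close>, then \<open>\<bar>d\<^sub>k\<bar>\<close> is at most about \<open>min 1 (n / k - 1)\<close>, so the average of
  \<open>d\<^sub>k\<^sup>2\<close> is below \<open>5/7\<close>. By concavity of the logarithm the product of the factors is then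
  \<open>O(58\<^sup>n)\<close>, and \<open>58\<close> is less than \<open>8\<close> to the power \<open>2 (1 - 1/50)\<close>.\<close>

section \<open>The edges of a new pair of nodes under a fixed coloring\<close>

lemma expectation_bind_pmf_finite:
  fixes h :: "'b \<Rightarrow> real"
  assumes "finite (set_pmf p)" "\<And>x. x \<in> set_pmf p \<Longrightarrow> finite (set_pmf (f x))"
  shows "measure_pmf.expectation (p \<bind> f) h
    = measure_pmf.expectation p (\<lambda>x. measure_pmf.expectation (f x) h)"
  by (subst pmf_expectation_bind[OF assms order.refl], simp,
      subst integral_measure_pmf[OF assms(1)]) auto

text \<open>Encodes a valid coloring by the set \<open>S\<close> of its correctly colored labels,
  all other pairs being swapped. The union over colorings thus becomes a union over the finitely
  many subsets of \<open>{1..n}\<close>.\<close>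

definition coloring_of :: "nat set \<Rightarrow> node \<Rightarrow> community" where
  "coloring_of S v = (if fst v \<in> S then snd v else other (snd v))"

definition correct_frac :: "nat \<Rightarrow> nat set \<Rightarrow> real" where
  "correct_frac k S = real (card (S \<inter> {1..k})) / real k"

text \<open>The probability that a new node of label \<open>Suc k\<close> is joined to a parent of
  its own color under \<open>coloring_of S\<close>. It is the same for both types and does not
  depend on the tree built so far.\<close>

definition mono_prob :: "real \<Rightarrow> nat \<Rightarrow> nat set \<Rightarrow> real" where
  "mono_prob q k S = (let x = correct_frac k S in
     if Suc k \<in> S then (1 - q) * x + q * (1 - x) else (1 - q) * (1 - x) + q * x)"

lemma other_neq [simp]: "other c \<noteq> c" "c \<noteq> other c"
  by (cases c; simp)+

lemma correct_frac_bounds: "0 \<le> correct_frac k S" "correct_frac k S \<le> 1"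
proof -
  have "card (S \<inter> {1..k}) \<le> k"
    using card_mono[of "{1..k}" "S \<inter> {1..k}"] by simp
  then show "0 \<le> correct_frac k S" "correct_frac k S \<le> 1"
    by (auto simp: correct_frac_def divide_le_eq)
qed

lemma mono_prob_nonneg: "0 \<le> q \<Longrightarrow> q \<le> 1 \<Longrightarrow> 0 \<le> mono_prob q k S"
  using correct_frac_bounds[of k S] by (simp add: mono_prob_def Let_def)

lemma parents_of_type_eq:
  "{v \<in> {1..k} \<times> UNIV. snd v = (if cross then other c else c)}
    = (\<lambda>i. (i, if cross then other c else c)) ` {1..k}"
  for c :: community by auto

lemma finite_set_parent_pmf:
  assumes "1 \<le> k"
  shows "finite (set_pmf (parent_pmf q k c))"
  using assms finite_subset[OF subset_UNIV finite, of "set_pmf (bernoulli_pmf q)"]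
  unfolding parent_pmf_def parents_of_type_eq by (auto simp: set_pmf_of_set)

lemma set_parent_pmf:
  assumes "1 \<le> k" "v \<in> set_pmf (parent_pmf q k c)"
  shows "fst v \<in> {1..k}"
  using assms unfolding parent_pmf_def parents_of_type_eq
  by (auto simp: set_pmf_of_set)

text \<open>If the parent has the type of the new node, the colors agree iff both labels are correct
  or both are swapped; if the types differ, iff exactly one label is correct. So the favorable
  parent labels are either the correct ones or the swapped ones.\<close>

lemma prob_uniform_parent:
  assumes "1 \<le> k"
  shows "measure_pmf.prob (pmf_of_set ((\<lambda>i. (i, d)) ` {1..k}))
           {v. coloring_of S v = coloring_of S (Suc k, c)}
    = (if Suc k \<in> S \<longleftrightarrow> d = c then correct_frac k S else 1 - correct_frac k S)"
proof -
  let ?I = "\<lambda>i. (i::nat, d)"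
  have card_Diff: "card ({1..k} - S) = k - card (S \<inter> {1..k})"
    by (metis card_Diff_subset_Int card_atLeastAtMost diff_Suc_1 finite_Int finite_atLeastAtMost inf_commute)
  have card_le: "card (S \<inter> {1..k}) \<le> k"
    using card_mono[of "{1..k}" "S \<inter> {1..k}"] by simp
  have "?I ` {1..k} \<inter> {v. coloring_of S v = coloring_of S (Suc k, c)}
      = ?I ` (if Suc k \<in> S \<longleftrightarrow> d = c then S \<inter> {1..k} else {1..k} - S)"
    by (cases c; cases d) (auto simp: coloring_of_def split: if_splits)
  moreover have "inj_on ?I X" for X
    by (auto simp: inj_on_def)
  ultimately show ?thesis
    using assms card_le
    by (subst measure_pmf_of_set)
       (auto simp: card_image card_Diff correct_frac_def diff_divide_distrib simp del: One_nat_def)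
qed

lemma prob_parent_mono:
  assumes "0 \<le> q" "q \<le> 1" "1 \<le> k"
  shows "measure_pmf.prob (parent_pmf q k c) {v. coloring_of S v = coloring_of S (Suc k, c)}
    = mono_prob q k S"
proof -
  let ?X = "{v. coloring_of S v = coloring_of S (Suc k, c)}"
  have fin: "finite (set_pmf (bernoulli_pmf q))"
    by (rule finite_subset[OF subset_UNIV]) simp
  have "measure_pmf.prob (parent_pmf q k c) ?X
      = measure_pmf.expectation (parent_pmf q k c) (indicator ?X)"
    by simp
  also have "\<dots> = measure_pmf.expectation (bernoulli_pmf q)
      (\<lambda>x. measure_pmf.prob (pmf_of_set ((\<lambda>i. (i, if x then other c else c)) ` {1..k})) ?X)"
    unfolding parent_pmf_def parents_of_type_eq
    by (subst expectation_bind_pmf_finite[OF fin]) (use assms in \<open>auto simp: set_pmf_of_set\<close>)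
  also have "\<dots> = mono_prob q k S"
    using assms
    by (subst integral_bernoulli_pmf)
       (auto simp: prob_uniform_parent mono_prob_def Let_def simp del: One_nat_def)
  finally show ?thesis .
qed

lemma finite_set_bcmrt: "finite (set_pmf (bcmrt q n))"
proof (induction q n rule: bcmrt.induct)
  case (3 q k)
  then show ?case
    using finite_set_parent_pmf[of "Suc k" q] by auto
qed auto

text \<open>Ensures that only the colors of labels in \<open>{1..n}\<close> matter, and that the
  cardinality in \<open>mono_edges\<close> is that of a finite set.\<close>

lemma edges_bcmrt:
  "T \<in> set_pmf (bcmrt q n) \<Longrightarrow> finite T \<and> (\<forall>e\<in>T. fst ` e \<subseteq> {1..n})"
proof (induction q n arbitrary: T rule: bcmrt.induct)
  case (3 q k)
  then obtain T' a b where T': "T' \<in> set_pmf (bcmrt q (Suc k))"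
    and ab: "a \<in> set_pmf (parent_pmf q (Suc k) A)" "b \<in> set_pmf (parent_pmf q (Suc k) B)"
    and T: "T = T' \<union> {{(Suc (Suc k), A), a}, {(Suc (Suc k), B), b}}"
    by auto
  have "fst a \<in> {1..Suc k}" "fst b \<in> {1..Suc k}"
    using set_parent_pmf[OF _ ab(1)] set_parent_pmf[OF _ ab(2)] by simp_all
  moreover have "finite T'" "\<And>e. e \<in> T' \<Longrightarrow> fst ` e \<subseteq> {1..Suc k}"
    using 3(1)[OF T'] by blast+
  moreover have "{1..Suc k} \<subseteq> {1..Suc (Suc k)}" by simp
  ultimately have "finite T" "\<And>e. e \<in> T' \<Longrightarrow> fst ` e \<subseteq> {1..Suc (Suc k)}"
    "fst ` {(Suc (Suc k), A), a} \<subseteq> {1..Suc (Suc k)}" "fst ` {(Suc (Suc k), B), b} \<subseteq> {1..Suc (Suc k)}"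
    unfolding T by (blast | simp)+
  then show ?case
    unfolding T by blast
qed auto

section \<open>Exponential moment of the number of monochromatic edges\<close>

lemma mono_edges_insert_le:
  assumes "finite T"
  shows "mono_edges (insert {u, v} T) \<sigma> \<le> mono_edges T \<sigma> + (if \<sigma> v = \<sigma> u then 1 else 0)"
proof -
  \<comment> \<open>An inclusion is enough for an upper bound and avoids a case distinction on
    whether \<open>{u, v}\<close> already lies in \<open>T\<close>.\<close>
  have "{e \<in> insert {u, v} T. \<forall>u\<in>e. \<forall>v\<in>e. \<sigma> u = \<sigma> v}
      \<subseteq> {e \<in> T. \<forall>u\<in>e. \<forall>v\<in>e. \<sigma> u = \<sigma> v} \<union> (if \<sigma> v = \<sigma> u then {{u, v}} else {})"
    by auto
  from card_mono[OF _ this]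
  have "mono_edges (insert {u, v} T) \<sigma>
      \<le> card ({e \<in> T. \<forall>u\<in>e. \<forall>v\<in>e. \<sigma> u = \<sigma> v} \<union> (if \<sigma> v = \<sigma> u then {{u, v}} else {}))"
    using assms by (simp add: mono_edges_def)
  also have "\<dots> \<le> mono_edges T \<sigma> + card (if \<sigma> v = \<sigma> u then {{u, v}} else {})"
    unfolding mono_edges_def by (rule card_Un_le)
  also have "card (if \<sigma> v = \<sigma> u then {{u, v}} else {}) = (if \<sigma> v = \<sigma> u then 1 else 0)"
    by simp
  finally show ?thesis .
qed

text \<open>Since 8 to the power of an indicator is 1 + 7 times the indicator, only the probability
  of a monochromatic edge enters.\<close>

lemma expectation_pow_mono_edge:
  assumes "0 \<le> q" "q \<le> 1" "1 \<le> k"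
  shows "measure_pmf.expectation (parent_pmf q k c)
      (\<lambda>v. 8 ^ (if coloring_of S v = coloring_of S (Suc k, c) then 1 else 0))
    = 1 + 7 * mono_prob q k S"
proof -
  let ?X = "{v. coloring_of S v = coloring_of S (Suc k, c)}"
  have eq: "(\<lambda>v. 8 ^ (if coloring_of S v = coloring_of S (Suc k, c) then 1 else 0))
      = (\<lambda>v. 1 + 7 * indicator ?X v :: real)"
    by (auto simp: indicator_def)
  show ?thesis
    unfolding eq
    by (subst Bochner_Integration.integral_add)
       (use assms in \<open>auto intro!: integrable_measure_pmf_finite finite_set_parent_pmf
          simp: prob_parent_mono[OF assms]\<close>)
qed

text \<open>Given the tree, the two new parents are independent and each contributes the same
  factor, which depends on \<open>k\<close> and \<open>S\<close> only. Hence every step multiplies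
  the bound by the square of that factor.\<close>

lemma expectation_pow_mono_edges_le:
  assumes "0 \<le> q" "q \<le> 1"
  shows "measure_pmf.expectation (bcmrt q (Suc m)) (\<lambda>T. 8 ^ mono_edges T (coloring_of S))
    \<le> (\<Prod>k=1..m. (1 + 7 * mono_prob q k S)\<^sup>2)"
proof (induction m)
  case 0
  \<comment> \<open>The root edge joins the two nodes of one label, so it is never monochromatic and
    contributes no factor.\<close>
  have "\<not> (coloring_of S (1, A) = coloring_of S (1, B))"
    by (auto simp: coloring_of_def)
  then have "mono_edges {{(1, A), (1, B)}} (coloring_of S) = 0"
    by (auto simp: mono_edges_def)
  then show ?case by simp
next
  case (Suc m)
  let ?\<sigma> = "coloring_of S" and ?k = "Suc m"
  let ?P = "\<lambda>c. parent_pmf q ?k c"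
  let ?u = "\<lambda>c v. 8 ^ (if ?\<sigma> v = ?\<sigma> (Suc ?k, c) then 1 else 0) :: real"
  let ?g = "\<lambda>T. (8::real) ^ mono_edges T ?\<sigma>"
  let ?p = "1 + 7 * mono_prob q ?k S"
  have fin: "finite (set_pmf (?P c))" for c
    by (rule finite_set_parent_pmf) simp
  have step: "?g (T \<union> {{(Suc ?k, A), a}, {(Suc ?k, B), b}}) \<le> ?g T * (?u A a * ?u B b)"
    if "finite T" for T a b
  proof -
    have "mono_edges (insert {(Suc ?k, A), a} (insert {(Suc ?k, B), b} T)) ?\<sigma>
        \<le> mono_edges T ?\<sigma> + (if ?\<sigma> b = ?\<sigma> (Suc ?k, B) then 1 else 0)
          + (if ?\<sigma> a = ?\<sigma> (Suc ?k, A) then 1 else 0)"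
      using mono_edges_insert_le[of "insert {(Suc ?k, B), b} T" "(Suc ?k, A)" a ?\<sigma>]
        mono_edges_insert_le[of T "(Suc ?k, B)" b ?\<sigma>] that by simp
    then have "?g (insert {(Suc ?k, A), a} (insert {(Suc ?k, B), b} T))
        \<le> 8 ^ (mono_edges T ?\<sigma> + (if ?\<sigma> b = ?\<sigma> (Suc ?k, B) then 1 else 0)
          + (if ?\<sigma> a = ?\<sigma> (Suc ?k, A) then 1 else 0))"
      by (intro power_increasing) auto
    also have "\<dots> = ?g T * (?u A a * ?u B b)"
      by (simp only: power_add mult_ac)
    finally show ?thesis
      by (simp add: insert_commute)
  qed
  have "measure_pmf.expectation (bcmrt q (Suc ?k)) ?g
      = measure_pmf.expectation (bcmrt q ?k) (\<lambda>T. measure_pmf.expectation (?P A)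
          (\<lambda>a. measure_pmf.expectation (?P B)
            (\<lambda>b. ?g (T \<union> {{(Suc ?k, A), a}, {(Suc ?k, B), b}}))))"
    by (simp add: expectation_bind_pmf_finite finite_set_bcmrt fin del: insert_iff Un_insert_right)
  also have "\<dots> \<le> measure_pmf.expectation (bcmrt q ?k) (\<lambda>T. measure_pmf.expectation (?P A)
          (\<lambda>a. measure_pmf.expectation (?P B) (\<lambda>b. ?g T * (?u A a * ?u B b))))"
    by (intro integral_mono_AE integrable_measure_pmf_finite finite_set_bcmrt fin AE_pmfI step)
       (simp add: edges_bcmrt)
  \<comment> \<open>For fixed \<open>T\<close> the integrand splits into a function of
    \<open>a\<close> times a function of \<open>b\<close>, each of mean \<open>?p\<close>.\<close>
  also have "\<dots> = measure_pmf.expectation (bcmrt q ?k) (\<lambda>T. ?g T * ?p\<^sup>2)"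
    using expectation_pow_mono_edge[OF assms, of ?k _ S]
    by (simp add: power2_eq_square)
  also have "\<dots> = measure_pmf.expectation (bcmrt q ?k) ?g * ?p\<^sup>2"
    by simp
  also have "\<dots> \<le> (\<Prod>k=1..m. (1 + 7 * mono_prob q k S)\<^sup>2) * ?p\<^sup>2"
    by (intro mult_right_mono Suc.IH) auto
  also have "\<dots> = (\<Prod>k=1..Suc m. (1 + 7 * mono_prob q k S)\<^sup>2)"
    by simp
  finally show ?case .
qed

section \<open>Summation over all label sets\<close>

definition step_bound :: "nat \<Rightarrow> nat set \<Rightarrow> real" where
  "step_bound k S = (81 + 49 * (2 * correct_frac k S - 1)\<^sup>2) / 2"

lemma step_bound_pos: "0 < step_bound k S"
  by (simp add: step_bound_def add_pos_nonneg)

lemma correct_frac_insert [simp]: "k \<le> m \<Longrightarrow> correct_frac k (insert (Suc m) S) = correct_frac k S"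
  by (simp add: correct_frac_def)

lemma mono_prob_insert [simp]: "k < m \<Longrightarrow> mono_prob q k (insert (Suc m) S) = mono_prob q k S"
  by (simp add: mono_prob_def)

lemma step_bound_insert [simp]: "k \<le> m \<Longrightarrow> step_bound k (insert (Suc m) S) = step_bound k S"
  by (simp add: step_bound_def)

text \<open>With d the excess proportion of correct labels, the two values of
  \<open>mono_prob\<close> are (1 - (1 - 2q) d) / 2 and (1 + (1 - 2q) d) / 2. The two bases are
  therefore (9 - 7 (1 - 2q) d) / 2 and (9 + 7 (1 - 2q) d) / 2, and the mixed terms cancel in the sum
  of their squares. \<open>step_bound\<close> is the value of this sum at q = 0.\<close>

lemma sum_two_colors_le:
  assumes "0 \<le> q" "q \<le> 1" "S \<subseteq> {1..k}"
  shows "(1 + 7 * mono_prob q k S)\<^sup>2 + (1 + 7 * mono_prob q k (insert (Suc k) S))\<^sup>2 \<le> step_bound k S"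
proof -
  define d where "d = 2 * correct_frac k S - 1"
  have x: "correct_frac k S = (1 + d) / 2"
    by (simp add: d_def)
  have "Suc k \<notin> S"
    using assms(3) by auto
  then have "(1 + 7 * mono_prob q k S)\<^sup>2 + (1 + 7 * mono_prob q k (insert (Suc k) S))\<^sup>2
      = (81 + 49 * ((1 - 2 * q)\<^sup>2 * d\<^sup>2)) / 2"
    by (simp add: mono_prob_def Let_def x field_simps power2_eq_square)
  also have "(1 - 2 * q)\<^sup>2 * d\<^sup>2 \<le> 1 * d\<^sup>2"
    using assms by (intro mult_right_mono) (auto simp: abs_square_le_1)
  finally show ?thesis
    by (simp add: step_bound_def d_def)
qed

lemma sum_Pow_Suc:
  fixes f :: "nat set \<Rightarrow> real"
  shows "(\<Sum>S\<in>Pow {1..Suc m}. f S) = (\<Sum>S\<in>Pow {1..m}. f S + f (insert (Suc m) S))"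
proof -
  have "Pow {1..Suc m} = Pow {1..m} \<union> insert (Suc m) ` Pow {1..m}"
    by (simp add: atLeastAtMostSuc_conv Pow_insert)
  moreover have "inj_on (insert (Suc m)) (Pow {1..m})"
    by (intro inj_onI) (metis PowD atLeastAtMost_iff insert_ident not_less_eq_eq order_refl subsetD)
  ultimately show ?thesis
    by (subst (1) \<open>Pow {1..Suc m} = _\<close>, subst sum.union_disjoint)
       (auto simp: sum.reindex sum.distrib)
qed

text \<open>The factor of index \<open>k\<close> depends only on the labels up to
  \<open>Suc k\<close>. Summing over the membership of the largest label thus affects the last
  factor alone, and its two values add up to at most 1. The bound 2 counts the choices for label 1,
  which carries no factor.\<close>

lemma sum_normalised_weights_le:
  assumes "0 \<le> q" "q \<le> 1"
  shows "(\<Sum>S\<in>Pow {1..Suc m}. \<Prod>k=1..m. (1 + 7 * mono_prob q k S)\<^sup>2 / step_bound k S) \<le> 2"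
proof (induction m)
  case 0
  show ?case by (simp add: card_Pow)
next
  case (Suc m)
  let ?r = "\<lambda>k S. (1 + 7 * mono_prob q k S)\<^sup>2 / step_bound k S"
  have "(\<Sum>S\<in>Pow {1..Suc (Suc m)}. \<Prod>k=1..Suc m. ?r k S)
      = (\<Sum>S\<in>Pow {1..Suc m}. (\<Prod>k=1..m. ?r k S) * (?r (Suc m) S + ?r (Suc m) (insert (Suc (Suc m)) S)))"
    by (subst sum_Pow_Suc) (auto intro!: sum.cong simp: distrib_left)
  also have "\<dots> \<le> (\<Sum>S\<in>Pow {1..Suc m}. (\<Prod>k=1..m. ?r k S) * 1)"
  proof (intro sum_mono mult_left_mono)
    fix S assume "S \<in> Pow {1..Suc m}"
    then show "?r (Suc m) S + ?r (Suc m) (insert (Suc (Suc m)) S) \<le> 1"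
      using sum_two_colors_le[OF assms, of S "Suc m"] step_bound_pos[of "Suc m" S]
      by (simp add: add_divide_distrib [symmetric])
    show "0 \<le> (\<Prod>k=1..m. ?r k S)"
      by (intro prod_nonneg) (simp add: less_imp_le[OF step_bound_pos])
  qed
  also have "\<dots> \<le> 2"
    using Suc.IH by simp
  finally show ?case .
qed

section \<open>Bias of nearly balanced label sets\<close>

lemma sum_bias_squared_le:
  fixes n :: nat
  assumes S: "S \<subseteq> {1..n}" and bal: "\<bar>real (card S) - real n / 2\<bar> \<le> real n / 100" and "n \<ge> 1"
  shows "(\<Sum>k=1..<n. (2 * correct_frac k S - 1)\<^sup>2) \<le> 5/7 * (real n - 1) + 2"
proof -
  let ?d = "\<lambda>k. 2 * correct_frac k S - 1"
  let ?J = "\<lambda>a::real. {k \<in> {1..<n}. a * real n \<le> real k}"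
  \<comment> \<open>the labels after \<open>k\<close> can change the imbalance by at most \<open>n - k\<close>\<close>
  have late: "\<bar>?d k\<bar> \<le> (51/50 * real n - real k) / real k" if "k \<in> {1..<n}" for k
  proof -
    have "S = (S \<inter> {1..k}) \<union> (S \<inter> {k<..n})"
      using S that by auto
    then have "card S = card (S \<inter> {1..k}) + card (S \<inter> {k<..n})"
      by (metis (no_types, lifting) card_Un_disjoint disjoint_iff finite_Int finite_atLeastAtMost
          finite_greaterThanAtMost Int_iff atLeastAtMost_iff greaterThanAtMost_iff not_le)
    moreover have "real (card (S \<inter> {k<..n})) \<le> real n - real k"
    proof -
      have "card (S \<inter> {k<..n}) + k \<le> n"
        using card_mono[of "{k<..n}" "S \<inter> {k<..n}"] that by (auto simp: le_diff_conv2)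
      then have "real (card (S \<inter> {k<..n}) + k) \<le> real n"
        by (rule of_nat_mono)
      then show ?thesis by simp
    qed
    \<comment> \<open>The final imbalance of twice the count is at most n/50, twice the tolerance
      n/100; the labels after \<open>k\<close> add at most n - k.\<close>
    ultimately have "\<bar>2 * real (card (S \<inter> {1..k})) - real k\<bar> \<le> 51/50 * real n - real k"
      using bal by (simp only: of_nat_add)
    then show ?thesis
      using that by (simp add: correct_frac_def field_simps abs_le_iff)
  qed
  \<comment> \<open>A step function with three values dominates the squared bias. The bound
    \<open>late\<close> gives 1.02 / 0.6 - 1 = 0.7 from 3n/5 on and 1.02 / 0.75 - 1 = 0.36 from 3n/4
    on; moreover 0.7 squared is 1 - 0.51, and 0.36 squared is at most 1 - 0.51 - 0.36.\<close>
  have pointwise: "(?d k)\<^sup>2 \<le> 1 - 51/100 * (if 3/5 * real n \<le> real k then 1 else 0)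
      - 36/100 * (if 3/4 * real n \<le> real k then 1 else 0)" if k: "k \<in> {1..<n}" for k
  proof -
    have sq: "(?d k)\<^sup>2 \<le> c\<^sup>2" if "\<bar>?d k\<bar> \<le> c" for c
      using power_mono[OF that, of 2] by simp
    have "(?d k)\<^sup>2 \<le> 1\<^sup>2"
      by (rule sq) (use correct_frac_bounds[of k S] in auto)
    moreover have "(?d k)\<^sup>2 \<le> (7/10)\<^sup>2" if "3/5 * real n \<le> real k"
    proof (rule sq, rule order.trans[OF late[OF k]])
      show "(51/50 * real n - real k) / real k \<le> 7/10"
        using that k by (simp add: divide_le_eq)
    qed
    moreover have "(?d k)\<^sup>2 \<le> (9/25)\<^sup>2" if "3/4 * real n \<le> real k"
    proof (rule sq, rule order.trans[OF late[OF k]])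
      show "(51/50 * real n - real k) / real k \<le> 9/25"
        using that k by (simp add: divide_le_eq)
    qed
    ultimately show ?thesis
      using that by (auto simp: power2_eq_square)
  qed
  have card_J: "(1 - a) * real n - 1 \<le> real (card (?J a))" if "0 < a" "a \<le> 1" for a
  proof -
    have "{nat \<lceil>a * real n\<rceil>..<n} \<subseteq> ?J a"
    proof
      fix k assume "k \<in> {nat \<lceil>a * real n\<rceil>..<n}"
      then have "a * real n \<le> real k" "k < n"
        by (auto simp: nat_le_iff ceiling_le_iff)
      moreover have "0 < a * real n"
        using that \<open>n \<ge> 1\<close> by simp
      ultimately show "k \<in> ?J a" by auto
    qed
    then have "card {nat \<lceil>a * real n\<rceil>..<n} \<le> card (?J a)"
      by (intro card_mono) auto
    moreover have "real (nat \<lceil>a * real n\<rceil>) \<le> a * real n + 1"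
      using that by (simp add: of_nat_nat)
    ultimately show ?thesis
      by (simp add: algebra_simps)
  qed
  have count_J: "(\<Sum>k=1..<n. if a * real n \<le> real k then 1 else 0) = real (card (?J a))" for a
    by (simp add: sum.If_cases Int_def)
  have "(\<Sum>k=1..<n. (?d k)\<^sup>2) \<le> (\<Sum>k=1..<n. 1 - 51/100 * (if 3/5 * real n \<le> real k then 1 else 0)
      - 36/100 * (if 3/4 * real n \<le> real k then 1 else 0))"
    by (intro sum_mono pointwise)
  also have "\<dots> = (real n - 1) - 51/100 * real (card (?J (3/5))) - 36/100 * real (card (?J (3/4)))"
    using \<open>n \<ge> 1\<close>
    by (simp only: sum_subtractf sum_distrib_left [symmetric] count_J) (simp add: of_nat_diff)
  \<comment> \<open>The coefficient of n is 1 - 0.51 * 2/5 - 0.36 * 1/4 = 0.706, which is below 5/7;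
    the constant 2 covers the rounding.\<close>
  also have "\<dots> \<le> 5/7 * (real n - 1) + 2"
  proof -
    have "2/5 * real n - 1 \<le> real (card (?J (3/5)))" "1/4 * real n - 1 \<le> real (card (?J (3/4)))" "0 \<le> real n"
      using card_J[of "3/5"] card_J[of "3/4"] by simp_all
    then show ?thesis by argo
  qed
  finally show ?thesis .
qed

lemma prod_step_bound_le:
  assumes "S \<subseteq> {1..Suc m}" "\<bar>real (card S) - real (Suc m) / 2\<bar> \<le> real (Suc m) / 100"
  shows "(\<Prod>k=1..m. step_bound k S) \<le> 58 ^ m * exp 1"
proof -
  let ?d = "\<lambda>k. 2 * correct_frac k S - 1"
  \<comment> \<open>tangent of the exponential at \<open>d\<^sup>2 = 5/7\<close>, where the step bound equals \<open>58\<close>\<close>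
  have "step_bound k S \<le> 58 * exp (49/116 * ((?d k)\<^sup>2 - 5/7))" for k
    unfolding step_bound_def
    using exp_ge_add_one_self[of "49/116 * ((?d k)\<^sup>2 - 5/7)"] by argo
  then have "(\<Prod>k=1..m. step_bound k S) \<le> (\<Prod>k=1..m. 58 * exp (49/116 * ((?d k)\<^sup>2 - 5/7)))"
    by (intro prod_mono) (auto intro: less_imp_le step_bound_pos)
  also have "\<dots> = 58 ^ m * exp (49/116 * ((\<Sum>k=1..m. (?d k)\<^sup>2) - 5/7 * real m))"
  proof -
    have "(\<Sum>k=1..m. 49/116 * ((?d k)\<^sup>2 - 5/7)) = 49/116 * ((\<Sum>k=1..m. (?d k)\<^sup>2) - 5/7 * real m)"
      by (simp only: sum_distrib_left [symmetric] sum_subtractf sum_constant) simp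
    then show ?thesis
      by (simp only: prod.distrib exp_sum [OF finite_atLeastAtMost, symmetric] prod_constant) simp
  qed
  \<comment> \<open>The additive constant 2 in the bound on the squared biases costs only exp
    (49/58).\<close>
  also have "\<dots> \<le> 58 ^ m * exp 1"
    using sum_bias_squared_le[OF assms]
    by (simp add: atLeastLessThanSuc_atLeastAtMost)
  finally show ?thesis .
qed

section \<open>From valid colorings to label sets, and the union bound\<close>

lemma all_community: "(\<forall>c. P c) \<longleftrightarrow> P A \<and> P B"
  by (metis community.exhaust)

text \<open>Validity leaves two possibilities for each pair, both nodes correct or both swapped, so
  the set of correct labels determines the coloring on \<open>{1..n}\<close>.\<close>

lemma valid_coloring_eq_coloring_of:
  assumes "valid_coloring n \<sigma>" "i \<in> {1..n}"
  shows "\<sigma> (i, c) = coloring_of {i \<in> {1..n}. \<forall>c. \<sigma> (i, c) = true_coloring (i, c)} (i, c)"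
proof -
  let ?S = "{i \<in> {1..n}. \<forall>c. \<sigma> (i, c) = true_coloring (i, c)}"
  have "{\<sigma> (i, A), \<sigma> (i, B)} = {A, B}"
    using assms unfolding valid_coloring_def by (rule bspec)
  then have "\<sigma> (i, A) = A \<and> \<sigma> (i, B) = B \<or> \<sigma> (i, A) = B \<and> \<sigma> (i, B) = A"
    by (simp only: doubleton_eq_iff)
  moreover have "i \<in> ?S \<longleftrightarrow> \<sigma> (i, A) = A \<and> \<sigma> (i, B) = B"
    using assms(2) by (simp only: mem_Collect_eq all_community true_coloring_def snd_conv simp_thms)
  ultimately show ?thesis
    unfolding coloring_of_def by (cases c) auto
qed

lemma mono_edges_cong:
  assumes "\<And>e v. e \<in> T \<Longrightarrow> v \<in> e \<Longrightarrow> \<sigma> v = \<tau> v"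
  shows "mono_edges T \<sigma> = mono_edges T \<tau>"
proof -
  have "(\<forall>u\<in>e. \<forall>v\<in>e. \<sigma> u = \<sigma> v) \<longleftrightarrow> (\<forall>u\<in>e. \<forall>v\<in>e. \<tau> u = \<tau> v)" if "e \<in> T" for e
    using assms[OF that] by metis
  then show ?thesis
    unfolding mono_edges_def by (metis (no_types, lifting))
qed

lemma Markov_pow_mono_edges:
  "measure_pmf.prob (bcmrt q n) {T. x \<le> real (mono_edges T \<sigma>)}
    \<le> measure_pmf.expectation (bcmrt q n) (\<lambda>T. 8 ^ mono_edges T \<sigma>) / 8 powr x"
proof -
  have "{T. x \<le> real (mono_edges T \<sigma>)} = {T \<in> space (measure_pmf (bcmrt q n)). 8 powr x \<le> 8 ^ mono_edges T \<sigma>}"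
  proof -
    have "8 powr x \<le> 8 ^ k \<longleftrightarrow> x \<le> real k" for k
      using powr_le_cancel_iff[of 8 x "real k"] powr_realpow[of 8 k] by linarith
    then show ?thesis by simp
  qed
  then show ?thesis
    by (simp only:) (rule integral_Markov_inequality_measure[where A = UNIV],
        auto intro: integrable_measure_pmf_finite finite_set_bcmrt)
qed

text \<open>Union bound over the balanced label sets, with Markov's inequality for each. The sets
  are not counted separately: each weight is a product of \<open>step_bound\<close> factors,
  controlled by balance, times normalised factors, whose sum over all label sets is at most
  2.\<close>

lemma prob_balanced_coloring_le:
  fixes m :: nat
  assumes q: "0 \<le> q" "q \<le> 1"
  defines "n \<equiv> Suc m"
  shows "measure_pmf.prob (bcmrt q n)
      {T. \<exists>\<sigma>. valid_coloring n \<sigma> \<and> \<bar>real (correct_pairs n \<sigma>) - real n / 2\<bar> \<le> 1/100 * real n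
        \<and> real (mono_edges T \<sigma>) \<ge> x} \<le> 2 * 58 ^ m * exp 1 / 8 powr x"
    (is "measure_pmf.prob ?p ?E \<le> _")
proof -
  let ?Bal = "{S \<in> Pow {1..n}. \<bar>real (card S) - real n / 2\<bar> \<le> real n / 100}"
  let ?w = "\<lambda>k S. (1 + 7 * mono_prob q k S)\<^sup>2"
  have fin: "finite ?Bal" by simp
  \<comment> \<open>On the support all edges use labels in \<open>{1..n}\<close>, where
    \<open>\<sigma>\<close> agrees with some \<open>coloring_of S\<close>.\<close>
  have "measure_pmf.prob ?p ?E = measure_pmf.prob ?p (?E \<inter> set_pmf ?p)"
    by (simp add: measure_Int_set_pmf)
  also have "\<dots> \<le> measure_pmf.prob ?p (\<Union>S\<in>?Bal. {T. x \<le> real (mono_edges T (coloring_of S))})"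
  proof (intro measure_pmf.finite_measure_mono subsetI)
    fix T assume "T \<in> ?E \<inter> set_pmf ?p"
    then obtain \<sigma> where T: "T \<in> set_pmf ?p" and \<sigma>: "valid_coloring n \<sigma>"
      "\<bar>real (correct_pairs n \<sigma>) - real n / 2\<bar> \<le> 1/100 * real n" "real (mono_edges T \<sigma>) \<ge> x"
      by auto
    let ?S = "{i \<in> {1..n}. \<forall>c. \<sigma> (i, c) = true_coloring (i, c)}"
    have "mono_edges T \<sigma> = mono_edges T (coloring_of ?S)"
    proof (rule mono_edges_cong)
      fix e v assume "e \<in> T" "v \<in> e"
      then have "fst v \<in> {1..n}"
        using edges_bcmrt[OF T] by blast
      then show "\<sigma> v = coloring_of ?S v"
        using valid_coloring_eq_coloring_of[OF \<sigma>(1), of "fst v" "snd v"] by simp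
    qed
    with \<sigma>(3) have "T \<in> {T. x \<le> real (mono_edges T (coloring_of ?S))}"
      by simp
    moreover have "?S \<in> ?Bal"
      using \<sigma>(2) by (auto simp: correct_pairs_def)
    ultimately show "T \<in> (\<Union>S\<in>?Bal. {T. x \<le> real (mono_edges T (coloring_of S))})"
      by blast
  qed simp
  also have "\<dots> \<le> (\<Sum>S\<in>?Bal. measure_pmf.prob ?p {T. x \<le> real (mono_edges T (coloring_of S))})"
    by (rule measure_pmf.finite_measure_subadditive_finite[OF fin]) auto
  also have "\<dots> \<le> (\<Sum>S\<in>?Bal. (\<Prod>k=1..m. ?w k S) / 8 powr x)"
    unfolding n_def
    by (intro sum_mono order.trans[OF Markov_pow_mono_edges] divide_right_mono
        expectation_pow_mono_edges_le q) auto
  also have "\<dots> = (\<Sum>S\<in>?Bal. \<Prod>k=1..m. ?w k S) / 8 powr x"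
    by (simp add: sum_divide_distrib)
  also have "(\<Sum>S\<in>?Bal. \<Prod>k=1..m. ?w k S) \<le> (\<Sum>S\<in>?Bal. (58 ^ m * exp 1) * (\<Prod>k=1..m. ?w k S / step_bound k S))"
  proof (rule sum_mono)
    fix S assume S: "S \<in> ?Bal"
    have "(\<Prod>k=1..m. ?w k S) = (\<Prod>k=1..m. step_bound k S * (?w k S / step_bound k S))"
      using step_bound_pos by (intro prod.cong refl) (simp add: less_imp_neq[symmetric])
    also have "\<dots> = (\<Prod>k=1..m. step_bound k S) * (\<Prod>k=1..m. ?w k S / step_bound k S)"
      by (rule prod.distrib)
    also have "\<dots> \<le> (58 ^ m * exp 1) * (\<Prod>k=1..m. ?w k S / step_bound k S)"
      using S by (intro mult_right_mono prod_step_bound_le prod_nonneg)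
        (auto simp: n_def less_imp_le[OF step_bound_pos])
    finally show "(\<Prod>k=1..m. ?w k S) \<le> (58 ^ m * exp 1) * (\<Prod>k=1..m. ?w k S / step_bound k S)" .
  qed
  also have "\<dots> = (58 ^ m * exp 1) * (\<Sum>S\<in>?Bal. \<Prod>k=1..m. ?w k S / step_bound k S)"
    by (simp add: sum_distrib_left)
  \<comment> \<open>The terms are nonnegative, so the sum may be enlarged to all label sets, where
    the recursion over labels applies.\<close>
  also have "\<dots> \<le> (58 ^ m * exp 1) * (\<Sum>S\<in>Pow {1..Suc m}. \<Prod>k=1..m. ?w k S / step_bound k S)"
    by (intro mult_left_mono sum_mono2 prod_nonneg) (auto simp: n_def less_imp_le[OF step_bound_pos])
  also have "\<dots> \<le> (58 ^ m * exp 1) * 2"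
    by (intro mult_left_mono sum_normalised_weights_le q) simp
  finally show ?thesis
    by (simp add: divide_right_mono mult_ac)
qed

section \<open>Comparison of growth rates and the limit\<close>

lemma ln_58_less: "ln 58 < 49/25 * ln (8::real)"
proof -
  have "real 25 * ln 58 = ln (58 ^ 25)"
    by (rule ln_realpow [symmetric])
  \<comment> \<open>This integer comparison is where the threshold 1/50 enters: 49/25 = 2 (1 -
    1/50).\<close>
  also have "\<dots> < ln (8 ^ 49)"
    by (subst ln_less_cancel_iff) simp_all
  also have "\<dots> = real 49 * ln 8"
    by (rule ln_realpow)
  finally show ?thesis by simp
qed

text \<open>The logarithm of the bound is -c (n - 1) + ln 8 * n powr (2/3) up to a constant, with c
  > 0, so the linear term dominates.\<close>

lemma bound_tendsto_0:
  "(\<lambda>n. 2 * 58 ^ (n - 1) * exp 1 / 8 powr (49/25 * (real n - 1) - real n powr (2/3))) \<longlonglongrightarrow> 0"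
proof -
  define c where "c = 49/25 * ln 8 - ln (58::real)"
  have "c > 0" using ln_58_less by (simp add: c_def)
  then have "(\<lambda>n::nat. 2 * exp 1 * exp (ln 8 * real n powr (2/3) - c * (real n - 1))) \<longlonglongrightarrow> 0"
    by real_asymp
  moreover have "\<forall>\<^sub>F n::nat in sequentially.
      2 * exp 1 * exp (ln 8 * real n powr (2/3) - c * (real n - 1))
      = 2 * 58 ^ (n - 1) * exp 1 / 8 powr (49/25 * (real n - 1) - real n powr (2/3))"
    \<comment> \<open>At n = 0 the truncated \<open>n - 1\<close> differs from
      \<open>real n - 1\<close>, so the identity is stated for positive n.\<close>
    using eventually_ge_at_top[of 1]
  proof eventually_elim
    case (elim n)
    have "(58::real) ^ (n - 1) = 58 powr (real n - 1)"
      using elim by (simp add: powr_realpow [symmetric] of_nat_diff)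
    also have "\<dots> = exp (ln 58 * (real n - 1))"
      by (simp add: powr_def mult.commute)
    finally have "2 * 58 ^ (n - 1) * exp 1 / 8 powr (49/25 * (real n - 1) - real n powr (2/3))
        = 2 * exp 1 * (exp (ln 58 * (real n - 1)) / exp ((49/25 * (real n - 1) - real n powr (2/3)) * ln 8))"
      by (simp add: powr_def)
    also have "\<dots> = 2 * exp 1 * exp (ln 58 * (real n - 1) - (49/25 * (real n - 1) - real n powr (2/3)) * ln 8)"
      by (simp only: exp_diff)
    also have "ln 58 * (real n - 1) - (49/25 * (real n - 1) - real n powr (2/3)) * ln 8
        = ln 8 * real n powr (2/3) - c * (real n - 1)"
      by (simp add: c_def algebra_simps)
    finally show ?case by simp
  qed
  ultimately show ?thesis
    by (rule Lim_transform_eventually)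
qed

theorem theorem5:
  "\<exists>\<epsilon>::real. \<exists>q_star::real. 0 < \<epsilon> \<and> 1/50 \<le> q_star \<and> q_star \<le> 1 \<and>
     (\<forall>q\<in>{0..q_star}.
        (\<lambda>n::nat. measure_pmf.prob (bcmrt q n)
           {T. \<exists>\<sigma>. valid_coloring n \<sigma>
                 \<and> \<bar>real (correct_pairs n \<sigma>) - real n / 2\<bar> \<le> \<epsilon> * real n
                 \<and> real (mono_edges T \<sigma>) \<ge> 2 * (1 - q) * (real n - 1) - real n powr (2/3)})
        \<longlonglongrightarrow> 0)"
proof (rule exI[of _ "1/100"], rule exI[of _ "1/50"], intro conjI ballI)
  fix q :: real assume q: "q \<in> {0..1/50}"
  let ?P = "\<lambda>n. measure_pmf.prob (bcmrt q n)
           {T. \<exists>\<sigma>. valid_coloring n \<sigma>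
                 \<and> \<bar>real (correct_pairs n \<sigma>) - real n / 2\<bar> \<le> 1/100 * real n
                 \<and> real (mono_edges T \<sigma>) \<ge> 2 * (1 - q) * (real n - 1) - real n powr (2/3)}"
  show "?P \<longlonglongrightarrow> 0"
  proof (rule tendsto_sandwich[OF _ _ tendsto_const bound_tendsto_0])
    show "\<forall>\<^sub>F n in sequentially. ?P n
        \<le> 2 * 58 ^ (n - 1) * exp 1 / 8 powr (49/25 * (real n - 1) - real n powr (2/3))"
      using eventually_ge_at_top[of 1]
    proof eventually_elim
      case (elim n)
      have "?P n \<le> 2 * 58 ^ (n - 1) * exp 1 / 8 powr (2 * (1 - q) * (real n - 1) - real n powr (2/3))"
        using prob_balanced_coloring_le[of q "n - 1"] q elim by simp
      \<comment> \<open>For q at most 1/50 the coefficient 2 (1 - q) is at least 49/25, which makes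
        the bound uniform in q.\<close>
      also have "\<dots> \<le> 2 * 58 ^ (n - 1) * exp 1 / 8 powr (49/25 * (real n - 1) - real n powr (2/3))"
        using q elim by (intro divide_left_mono powr_mono diff_right_mono mult_right_mono) auto
      finally show ?case .
    qed
  qed simp
qed simp_all

end
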